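(* Let $R$ be a unital associative ring in which $2$ is invertible, let $n>2$ be an integer, and let $M_n(R)$ be the ring of $n\times n$ matrices over $R$, with matrix units $e_{i,j}$. Then every derivation $\delta$ on $R$ can be extended to a derivation on $M_n(R)$; that is, for every derivation $\delta:R\to R$ there is a derivation $\bar D:M_n(R)\to M_n(R)$ such that $\bar D(\lambda e_{1,1})=\delta(\lambda)e_{1,1}$ for all $\lambda\in R$.
   Context: A derivation on a ring $S$ is a map $D:S\to S$ with $D(x+y)=D(x)+D(y)$ and $D(xy)=D(x)y+xD(y)$ for all $x,y\in S$. Here $e_{i,j}\in M_n(R)$ is the matrix with $1$ in position $(i,j)$ and $0$ elsewhere, and $R$ is identified with the subring $Re_{1,1}$ of $M_n(R)$ via $\lambda\mapsto\lambda e_{1,1}$. *)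

theory Defs
  imports "Jordan_Normal_Form.Matrix"
begin

(* S is the carrier of the ring: matrices of all dimensions share one type, so the
   n x n matrices are the set "carrier_mat n n" rather than a type. *)
definition derivation_on :: "'a::{plus,times} set \<Rightarrow> ('a \<Rightarrow> 'a) \<Rightarrow> bool" where
  "derivation_on S D \<longleftrightarrow>
     (\<forall>x\<in>S. D x \<in> S) \<and>
     (\<forall>x\<in>S. \<forall>y\<in>S. D (x + y) = D x + D y) \<and>
     (\<forall>x\<in>S. \<forall>y\<in>S. D (x * y) = D x * y + x * D y)"

(* Indices start at 0: the paper's e_{1,1} is "mat_unit n 0 0". *)
definition mat_unit :: "nat \<Rightarrow> nat \<Rightarrow> nat \<Rightarrow> 'a::{zero,one} mat" where
  "mat_unit n i j = mat n n (\<lambda>(k, l). if k = i \<and> l = j then 1 else 0)"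

end

theory Submission
  imports Defs
begin

text \<open>A derivation of the coefficient ring, applied entrywise, is a derivation of the matrix ring:
  each entry of a product is a sum of products, to which additivity and the Leibniz rule apply.\<close>

text \<open>Additivity forces \<open>\<delta> 0 = 0\<close>, so \<open>I\<close> may also be empty
  or infinite, where the sum is 0 by convention.\<close>

lemma derivation_on_UNIV_sum:
  fixes \<delta> :: "'a::ring \<Rightarrow> 'a"
  assumes "derivation_on UNIV \<delta>"
  shows "\<delta> (sum f I) = (\<Sum>i\<in>I. \<delta> (f i))"
proof -
  interpret Modules.additive \<delta>
    using assms by unfold_locales (simp add: derivation_on_def)
  show ?thesis by (rule sum)
qed

lemma derivation_on_map_mat:
  fixes \<delta> :: "'a::ring \<Rightarrow> 'a"
  assumes "derivation_on UNIV \<delta>"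
  shows "derivation_on (carrier_mat n n) (map_mat \<delta>)"
  unfolding derivation_on_def
proof (intro conjI ballI)
  fix A B :: "'a mat"
  assume A: "A \<in> carrier_mat n n" and B: "B \<in> carrier_mat n n"
  show "map_mat \<delta> (A + B) = map_mat \<delta> A + map_mat \<delta> B"
    using A B assms by (intro eq_matI) (auto simp: derivation_on_def)
  have "\<delta> (x * y) = \<delta> x * y + x * \<delta> y" for x y
    using assms by (simp add: derivation_on_def)
  \<comment> \<open>After Leibniz in each summand of an entry, \<open>sum.distrib\<close> separates
    the two kinds of terms into the corresponding entries of the two products.\<close>
  then show "map_mat \<delta> (A * B) = map_mat \<delta> A * B + A * map_mat \<delta> B"
    using A B
    by (intro eq_matI)
       (auto simp: scalar_prod_def derivation_on_UNIV_sum[OF assms] sum.distrib)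
qed simp

theorem theorem3p3:
  fixes \<delta> :: "'r::{ring,monoid_mult} \<Rightarrow> 'r"
    and n :: nat
  assumes two_invertible: "\<exists>h::'r. h * (1 + 1) = 1 \<and> (1 + 1) * h = 1"
    and n: "n > 2"
    and \<delta>: "derivation_on UNIV \<delta>"
  shows "\<exists>D :: 'r mat \<Rightarrow> 'r mat.
    derivation_on (carrier_mat n n) D \<and>
    (\<forall>r. D (r \<cdot>\<^sub>m mat_unit n 0 0) = \<delta> r \<cdot>\<^sub>m mat_unit n 0 0)"
proof (intro exI conjI allI)
  show "derivation_on (carrier_mat n n) (map_mat \<delta>)"
    using \<delta> by (rule derivation_on_map_mat)
  have "\<delta> 0 = 0"
    \<comment> \<open>Both sides of the sum rule collapse to 0 over the empty index set.\<close>
    using derivation_on_UNIV_sum[OF \<delta>, of _ "{}"] by simp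
  \<comment> \<open>Away from the corner the entries are \<open>r * 0 = 0\<close>, and
    \<open>\<delta> 0 = 0\<close> keeps them zero; the corner entry \<open>r * 1 = r\<close> goes to
    \<open>\<delta> r\<close>.\<close>
  then show "map_mat \<delta> (r \<cdot>\<^sub>m mat_unit n 0 0) = \<delta> r \<cdot>\<^sub>m mat_unit n 0 0" for r
    by (intro eq_matI) (auto simp: mat_unit_def)
qed

end
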